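(* Let $\Delta t>0$ and let $n\ge 0$. Let $\phi^{n},\tilde\phi^{n+1}$ be given functions on $\Omega$ and $r^n\in\mathbb{R}$ be given, and suppose that functions $\phi^{n+1},\mu^{n+1}$ on $\Omega$ and $r^{n+1}\in\mathbb{R}$ satisfy the first order semi-implicit scalar auxiliary variable scheme $$\frac{\phi^{n+1}-\phi^{n}}{\Delta t}=-M\mathcal{L}\mu^{n+1},$$ $$\mu^{n+1}=\epsilon^2\mathcal{L}\phi^{n+1}+\frac{r^{n+1}}{\sqrt{E_1(\tilde{\phi}^{n+1})+C_0}}F'(\tilde{\phi}^{n+1}),$$ $$\frac{r^{n+1}-r^{n}}{\Delta t}=\int_{\Omega}\frac{F'(\tilde{\phi}^{n+1})}{2\sqrt{E_1(\tilde{\phi}^{n+1})+C_0}}\,\frac{\phi^{n+1}-\phi^{n}}{\Delta t}\,d\mathbf{x}.$$ Then the scheme is unconditionally energy stable (no restriction on $\Delta t$), in the sense that $$\frac{\epsilon^2}{2}(\mathcal{L}\phi^{n+1},\phi^{n+1})+|r^{n+1}|^2\leq\frac{\epsilon^2}{2}(\mathcal{L}\phi^{n},\phi^{n})+|r^n|^2 .$$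
   Context: $\Omega\subseteq\mathbb{R}^d$ is a bounded domain, $M>0$ is the mobility constant, $\epsilon>0$ is a constant, and $F$ is a continuously differentiable nonlinear potential with derivative $F'$. The kernel $J$ satisfies: $J(\mathbf{x})\ge 0$; $J(\mathbf{x}-\mathbf{y})=J(\mathbf{y}-\mathbf{x})$; and $J$ is $\Omega$-periodic. The nonlocal diffusion operator is $$\mathcal{L}u(\mathbf{x})=\int_{\Omega}J(\mathbf{x}-\mathbf{y})[u(\mathbf{x})-u(\mathbf{y})]\,d\mathbf{y},\qquad \mathbf{x}\in\Omega.$$ The inner product is $(u,v)=\int_\Omega uv\,d\mathbf{x}$. Set $E_1(\phi)=\int_\Omega F(\phi)\,d\mathbf{x}$, which is assumed bounded below, $E_1(\phi)\ge -C_0$ for a constant $C_0$; it is understood that $E_1(\tilde\phi^{n+1})+C_0>0$ so the scheme makes sense. The function $\tilde\phi^{n+1}$ is any explicit (i.e. computed from previous time levels) $O(\Delta t)$ approximation of $\phi(t^{n+1})$, where $\phi(t)$ is the exact solution of $\phi_t=-M\mathcal{L}\mu$, $\mu=F'(\phi)+\epsilon^2\mathcal{L}\phi$, and $t^{n}=n\Delta t$. All functions and the kernel are assumed regular enough that all the integrals and inner products converge and the order of integration may be exchanged. *)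

theory Defs
  imports "HOL-Analysis.Analysis"
begin

text \<open>
  Functions on \<open>\<Omega>\<close> are total functions of which only the values on \<open>\<Omega>\<close> matter: all
  integrals are Bochner integrals with respect to Lebesgue measure restricted to \<open>\<Omega>\<close>.
  As usual the integral of a non-integrable function is \<open>0\<close> by convention, so
  convergence has to be assumed separately.
\<close>

definition nonlocal_op ::
  "(real^'d) set \<Rightarrow> (real^'d \<Rightarrow> real) \<Rightarrow> (real^'d \<Rightarrow> real) \<Rightarrow> real^'d \<Rightarrow> real" where
  "nonlocal_op \<Omega> J u x = (LINT y|lebesgue_on \<Omega>. J (x - y) * (u x - u y))"

definition inner_on ::
  "(real^'d) set \<Rightarrow> (real^'d \<Rightarrow> real) \<Rightarrow> (real^'d \<Rightarrow> real) \<Rightarrow> real" where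
  "inner_on \<Omega> u v = (LINT x|lebesgue_on \<Omega>. u x * v x)"

definition bulk_energy ::
  "(real^'d) set \<Rightarrow> (real \<Rightarrow> real) \<Rightarrow> (real^'d \<Rightarrow> real) \<Rightarrow> real" where
  "bulk_energy \<Omega> F u = (LINT x|lebesgue_on \<Omega>. F (u x))"

definition bounded_domain :: "(real^'d) set \<Rightarrow> bool" where
  "bounded_domain \<Omega> \<longleftrightarrow> open \<Omega> \<and> connected \<Omega> \<and> \<Omega> \<noteq> {} \<and> bounded \<Omega>"

text \<open>
  Periodicity with the side lengths of \<open>\<Omega>\<close> as periods. The side length in direction
  \<open>i\<close> is the extent of the \<open>i\<close>-th coordinate over \<open>\<Omega>\<close>, which is the \<open>i\<close>-th edge length
  when \<open>\<Omega>\<close> is a rectangular box; for other bounded domains this is the edge length of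
  the smallest axis-parallel box containing \<open>\<Omega>\<close>.
\<close>

definition side_length :: "(real^'d) set \<Rightarrow> 'd \<Rightarrow> real" where
  "side_length \<Omega> i = (SUP x\<in>\<Omega>. x $ i) - (INF x\<in>\<Omega>. x $ i)"

definition domain_periodic :: "(real^'d) set \<Rightarrow> (real^'d \<Rightarrow> real) \<Rightarrow> bool" where
  "domain_periodic \<Omega> J \<longleftrightarrow> (\<forall>x i. J (x + axis i (side_length \<Omega> i)) = J x)"

text \<open>
  Regularity for the pairing of \<open>nonlocal_op \<Omega> J u\<close> with \<open>v\<close>: the integral defining the
  operator converges at each point of \<open>\<Omega>\<close>, and the double integral over
  \<open>\<Omega> \<times> \<Omega>\<close> converges absolutely, so that by Fubini's theorem the pairing converges
  and the order of integration may be exchanged.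
\<close>

definition regular_pairing ::
  "(real^'d) set \<Rightarrow> (real^'d \<Rightarrow> real) \<Rightarrow> (real^'d \<Rightarrow> real) \<Rightarrow> (real^'d \<Rightarrow> real) \<Rightarrow> bool" where
  "regular_pairing \<Omega> J u v \<longleftrightarrow>
     (\<forall>x\<in>\<Omega>. integrable (lebesgue_on \<Omega>) (\<lambda>y. J (x - y) * (u x - u y))) \<and>
     integrable (lebesgue_on \<Omega> \<Otimes>\<^sub>M lebesgue_on \<Omega>)
       (\<lambda>(x, y). J (x - y) * (u x - u y) * v x)"

end

theory Submission
  imports Defs
begin

text \<open>
  Symmetrising the double integral over the exchange of \<open>x\<close> and \<open>y\<close> turns the pairing
  \<open>(L u, v)\<close> into one half of the integral of
  \<open>J (x - y) * (u x - u y) * (v x - v y)\<close>, which is symmetric in \<open>u\<close>, \<open>v\<close> and nonnegative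
  for \<open>u = v\<close>. Testing the equation for \<open>\<mu>\<close> with the increment of \<open>\<phi>\<close> gives
  \<open>\<epsilon>\<^sup>2 (L a, a - b) + 2 r' (r' - r) = - M \<Delta>t (L \<mu>, \<mu>) \<le> 0\<close> for the new and old states
  \<open>a\<close>, \<open>b\<close> and \<open>r'\<close>, \<open>r\<close>, and \<open>2 q(a, a - b) \<ge> q(a, a) - q(b, b)\<close> for every positive
  semidefinite symmetric form \<open>q\<close>.
\<close>

lemma pair_sigma_finite_lebesgue_on:
  assumes "\<Omega> \<in> lmeasurable"
  shows "pair_sigma_finite (lebesgue_on \<Omega>) (lebesgue_on \<Omega>)"
proof -
  interpret finite_measure "lebesgue_on \<Omega>"
    using assms by (rule finite_measure_lebesgue_on)
  show ?thesis by unfold_locales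
qed

text \<open>Fubini: the factor \<open>v x\<close> does not depend on \<open>y\<close>, so it moves
  into the integral defining the operator. What remains is an iterated integral of the product
  integrand, which is absolutely integrable by \<open>regular_pairing\<close>.\<close>

lemma
  assumes \<Omega>: "\<Omega> \<in> lmeasurable" and reg: "regular_pairing \<Omega> J u v"
  shows integrable_nonlocal_op_mult:
      "integrable (lebesgue_on \<Omega>) (\<lambda>x. nonlocal_op \<Omega> J u x * v x)"
    and inner_on_nonlocal_op:
      "inner_on \<Omega> (nonlocal_op \<Omega> J u) v =
        (LINT (x, y)|(lebesgue_on \<Omega> \<Otimes>\<^sub>M lebesgue_on \<Omega>). J (x - y) * (u x - u y) * v x)"
proof -
  interpret pair_sigma_finite "lebesgue_on \<Omega>" "lebesgue_on \<Omega>"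
    using \<Omega> by (rule pair_sigma_finite_lebesgue_on)
  have int: "integrable (lebesgue_on \<Omega> \<Otimes>\<^sub>M lebesgue_on \<Omega>)
      (\<lambda>(x, y). J (x - y) * (u x - u y) * v x)"
    using reg by (simp add: regular_pairing_def)
  \<comment> \<open>Valid for every \<open>x\<close>, also where the inner integral diverges: unless
    \<open>v x = 0\<close>, both integrals then take the default value 0.\<close>
  have op: "nonlocal_op \<Omega> J u x * v x = (LINT y|lebesgue_on \<Omega>. J (x - y) * (u x - u y) * v x)"
    for x by (simp add: nonlocal_op_def)
  show "integrable (lebesgue_on \<Omega>) (\<lambda>x. nonlocal_op \<Omega> J u x * v x)"
    unfolding op using integrable_fst'[OF int] by simp
  show "inner_on \<Omega> (nonlocal_op \<Omega> J u) v =
      (LINT (x, y)|(lebesgue_on \<Omega> \<Otimes>\<^sub>M lebesgue_on \<Omega>). J (x - y) * (u x - u y) * v x)"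
    unfolding inner_on_def op using integral_fst'[OF int] by simp
qed

lemma
  assumes \<Omega>: "\<Omega> \<in> lmeasurable" and reg: "regular_pairing \<Omega> J u v"
    and sym: "\<And>x y. J (x - y) = J (y - x)"
  shows integrable_symmetrized_pairing:
      "integrable (lebesgue_on \<Omega> \<Otimes>\<^sub>M lebesgue_on \<Omega>)
        (\<lambda>(x, y). J (x - y) * (u x - u y) * (v x - v y))"
    and inner_on_nonlocal_op_symmetrized:
      "2 * inner_on \<Omega> (nonlocal_op \<Omega> J u) v =
        (LINT (x, y)|(lebesgue_on \<Omega> \<Otimes>\<^sub>M lebesgue_on \<Omega>).
          J (x - y) * (u x - u y) * (v x - v y))"
proof -
  interpret pair_sigma_finite "lebesgue_on \<Omega>" "lebesgue_on \<Omega>"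
    using \<Omega> by (rule pair_sigma_finite_lebesgue_on)
  let ?P = "lebesgue_on \<Omega> \<Otimes>\<^sub>M lebesgue_on \<Omega>"
  let ?f = "\<lambda>(x, y). J (x - y) * (u x - u y) * v x"
  let ?g = "\<lambda>(x, y). ?f (y, x)"
  have f: "integrable ?P ?f"
    using reg by (simp add: regular_pairing_def)
  have g: "integrable ?P ?g"
    by (rule integrable_product_swap[OF f])
  \<comment> \<open>The swap turns \<open>u x - u y\<close> into its negative while \<open>J\<close>
    keeps its value, so \<open>?g\<close> supplies exactly the term with \<open>- v y\<close>. As
    the product measure is invariant under the swap, \<open>?f\<close> and \<open>?g\<close> have
    equal integrals, whence the factor 2.\<close>
  have "J (x - y) * (u x - u y) * (v x - v y) = ?f (x, y) + ?g (x, y)" for x y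
    using sym[of y x] by (simp add: algebra_simps)
  then have sum: "(\<lambda>(x, y). J (x - y) * (u x - u y) * (v x - v y)) = (\<lambda>p. ?f p + ?g p)"
    by (simp add: fun_eq_iff)
  show "integrable ?P (\<lambda>(x, y). J (x - y) * (u x - u y) * (v x - v y))"
    unfolding sum by (rule Bochner_Integration.integrable_add[OF f g])
  have "integral\<^sup>L ?P ?g = integral\<^sup>L ?P ?f"
    by (rule integral_product_swap[OF borel_measurable_integrable[OF f]])
  then show "2 * inner_on \<Omega> (nonlocal_op \<Omega> J u) v =
      (LINT (x, y)|?P. J (x - y) * (u x - u y) * (v x - v y))"
    unfolding sum inner_on_nonlocal_op[OF \<Omega> reg] Bochner_Integration.integral_add[OF f g]
    by simp
qed

text \<open>For \<open>v = u\<close> the symmetrized integrand is \<open>J\<close> times a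
  square.\<close>

lemma inner_on_nonlocal_op_nonneg:
  assumes "\<Omega> \<in> lmeasurable" "regular_pairing \<Omega> J u u"
    and "\<And>x y. J (x - y) = J (y - x)" "\<And>x. J x \<ge> 0"
  shows "inner_on \<Omega> (nonlocal_op \<Omega> J u) u \<ge> 0"
proof -
  have "0 \<le> (LINT (x, y)|(lebesgue_on \<Omega> \<Otimes>\<^sub>M lebesgue_on \<Omega>).
      J (x - y) * (u x - u y) * (u x - u y))"
    using assms(4) by (intro integral_nonneg_AE AE_I2) (auto simp: mult.assoc)
  then show ?thesis
    using inner_on_nonlocal_op_symmetrized[of \<Omega> J u u] assms by simp
qed

text \<open>Positivity of the form at \<open>u - v\<close>, obtained by expanding a square under the
  integral, so that regularity is only asked of pairings of \<open>u\<close> and \<open>v\<close>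
  themselves.\<close>

lemma inner_on_nonlocal_op_cross_le:
  assumes \<Omega>: "\<Omega> \<in> lmeasurable"
    and reg: "regular_pairing \<Omega> J u u" "regular_pairing \<Omega> J u v" "regular_pairing \<Omega> J v v"
    and sym: "\<And>x y. J (x - y) = J (y - x)" and nonneg: "\<And>x. J x \<ge> 0"
  shows "2 * inner_on \<Omega> (nonlocal_op \<Omega> J u) v
    \<le> inner_on \<Omega> (nonlocal_op \<Omega> J u) u + inner_on \<Omega> (nonlocal_op \<Omega> J v) v"
proof -
  let ?P = "lebesgue_on \<Omega> \<Otimes>\<^sub>M lebesgue_on \<Omega>"
  let ?k = "\<lambda>u v (x, y). J (x - y) * (u x - u y) * (v x - v y)"
  note int = integrable_symmetrized_pairing[OF \<Omega> reg(1) sym]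
    integrable_symmetrized_pairing[OF \<Omega> reg(2) sym]
    integrable_symmetrized_pairing[OF \<Omega> reg(3) sym]
  have "2 * integral\<^sup>L ?P (?k u v) = integral\<^sup>L ?P (\<lambda>p. 2 * ?k u v p)"
    by simp
  also have "\<dots> \<le> integral\<^sup>L ?P (\<lambda>p. ?k u u p + ?k v v p)"
  proof (rule integral_mono)
    fix p :: "(real^'a) \<times> (real^'a)"
    obtain x y where p: "p = (x, y)" by fastforce
    have "0 \<le> J (x - y) * ((u x - u y) - (v x - v y))\<^sup>2"
      using nonneg by simp
    then show "2 * ?k u v p \<le> ?k u u p + ?k v v p"
      by (simp add: p power2_eq_square algebra_simps)
  qed (use int in auto)
  also have "\<dots> = integral\<^sup>L ?P (?k u u) + integral\<^sup>L ?P (?k v v)"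
    by (rule Bochner_Integration.integral_add[OF int(1,3)])
  finally show ?thesis
    using inner_on_nonlocal_op_symmetrized[OF \<Omega> reg(1) sym]
      inner_on_nonlocal_op_symmetrized[OF \<Omega> reg(2) sym]
      inner_on_nonlocal_op_symmetrized[OF \<Omega> reg(3) sym] by simp
qed

theorem theorem3p1:
  fixes \<Omega> :: "(real^'d) set"
    and J :: "real^'d \<Rightarrow> real"
    and F F' :: "real \<Rightarrow> real"
    and M \<epsilon> C\<^sub>0 \<Delta>t :: real
    and \<phi> \<phi>t \<mu> :: "nat \<Rightarrow> real^'d \<Rightarrow> real"
    and r :: "nat \<Rightarrow> real"
    and n :: nat
  assumes domain: "bounded_domain \<Omega>"
    and params: "M > 0" "\<epsilon> > 0" "\<Delta>t > 0"
    and F_deriv: "\<And>s. (F has_real_derivative F' s) (at s)"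
    and F'_cont: "continuous_on UNIV F'"
    and J_nonneg: "\<And>x. J x \<ge> 0"
    and J_sym: "\<And>x y. J (x - y) = J (y - x)"
    and J_periodic: "domain_periodic \<Omega> J"
    and E1_bounded_below:
      "\<And>u. \<lbrakk>u \<in> borel_measurable (lebesgue_on \<Omega>); integrable (lebesgue_on \<Omega>) (\<lambda>x. F (u x))\<rbrakk>
             \<Longrightarrow> bulk_energy \<Omega> F u \<ge> - C\<^sub>0"
    and E1_pos: "bulk_energy \<Omega> F (\<phi>t (Suc n)) + C\<^sub>0 > 0"
    and reg_\<phi>: "\<And>i j. \<lbrakk>i \<in> {n, Suc n}; j \<in> {n, Suc n}\<rbrakk> \<Longrightarrow> regular_pairing \<Omega> J (\<phi> i) (\<phi> j)"
    and reg_\<mu>: "regular_pairing \<Omega> J (\<mu> (Suc n)) (\<mu> (Suc n))"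
    and reg_F: "integrable (lebesgue_on \<Omega>) (\<lambda>x. F (\<phi>t (Suc n) x))"
    and reg_F': "integrable (lebesgue_on \<Omega>) (\<lambda>x. F' (\<phi>t (Suc n) x) * (\<phi> (Suc n) x - \<phi> n x))"
    and scheme_\<phi>: "\<And>x. x \<in> \<Omega> \<Longrightarrow>
      (\<phi> (Suc n) x - \<phi> n x) / \<Delta>t = - M * nonlocal_op \<Omega> J (\<mu> (Suc n)) x"
    and scheme_\<mu>: "\<And>x. x \<in> \<Omega> \<Longrightarrow>
      \<mu> (Suc n) x = \<epsilon>\<^sup>2 * nonlocal_op \<Omega> J (\<phi> (Suc n)) x
        + r (Suc n) / sqrt (bulk_energy \<Omega> F (\<phi>t (Suc n)) + C\<^sub>0) * F' (\<phi>t (Suc n) x)"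
    and scheme_r:
      "(r (Suc n) - r n) / \<Delta>t =
        (LINT x|lebesgue_on \<Omega>.
          F' (\<phi>t (Suc n) x) / (2 * sqrt (bulk_energy \<Omega> F (\<phi>t (Suc n)) + C\<^sub>0))
            * ((\<phi> (Suc n) x - \<phi> n x) / \<Delta>t))"
  shows "\<epsilon>\<^sup>2 / 2 * inner_on \<Omega> (nonlocal_op \<Omega> J (\<phi> (Suc n))) (\<phi> (Suc n)) + \<bar>r (Suc n)\<bar>\<^sup>2
       \<le> \<epsilon>\<^sup>2 / 2 * inner_on \<Omega> (nonlocal_op \<Omega> J (\<phi> n)) (\<phi> n) + \<bar>r n\<bar>\<^sup>2"
proof -
  define a b m where "a = \<phi> (Suc n)" and "b = \<phi> n" and "m = \<mu> (Suc n)"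
  define s where "s = sqrt (bulk_energy \<Omega> F (\<phi>t (Suc n)) + C\<^sub>0)"
  define f where "f x = F' (\<phi>t (Suc n) x)" for x
  let ?L = "nonlocal_op \<Omega> J"
  let ?q = "\<lambda>u v. inner_on \<Omega> (?L u) v"
  let ?I = "integral\<^sup>L (lebesgue_on \<Omega>)"
  have \<Omega>: "\<Omega> \<in> lmeasurable"
    using domain by (simp add: bounded_domain_def lmeasurable_open)
  have reg: "regular_pairing \<Omega> J a a" "regular_pairing \<Omega> J a b"
      "regular_pairing \<Omega> J b b" "regular_pairing \<Omega> J m m"
    using reg_\<phi> reg_\<mu> by (auto simp: a_def b_def m_def)
  have s: "s > 0"
    using E1_pos by (simp add: s_def)
  note La = reg(1,2)[THEN integrable_nonlocal_op_mult[OF \<Omega>]]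
  have incr: "a x - b x = - (M * \<Delta>t) * ?L m x" if "x \<in> \<Omega>" for x
    using scheme_\<phi>[OF that] params(3) by (simp add: a_def b_def m_def field_simps)
  have f: "integrable (lebesgue_on \<Omega>) (\<lambda>x. f x * (a x - b x))"
    using reg_F' by (simp add: f_def a_def b_def)
  \<comment> \<open>The update of the auxiliary variable, cleared of the constant denominator
    \<open>2 * s * \<Delta>t\<close>.\<close>
  have r: "?I (\<lambda>x. f x * (a x - b x)) = 2 * s * (r (Suc n) - r n)"
  proof -
    have "(r (Suc n) - r n) / \<Delta>t = ?I (\<lambda>x. f x * (a x - b x) / (2 * s * \<Delta>t))"
      using scheme_r by (simp add: f_def a_def b_def s_def mult.assoc)
    also have "\<dots> = ?I (\<lambda>x. f x * (a x - b x)) / (2 * s * \<Delta>t)"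
      by (rule integral_divide_zero)
    finally show ?thesis
      using s params(3) by (simp add: divide_simps mult.commute)
  qed
  \<comment> \<open>The integral of \<open>(a - b) * m\<close> is evaluated in two ways: by
    substituting the first equation for \<open>a - b\<close>, and the second one for
    \<open>m\<close>.\<close>
  have "- (M * \<Delta>t) * ?q m m = ?I (\<lambda>x. - (M * \<Delta>t) * (?L m x * m x))"
    unfolding inner_on_def by simp
  \<comment> \<open>The integrand is grouped into the products whose integrability is at hand in
    \<open>La\<close> and \<open>f\<close>, so that the integral can be split.\<close>
  also have "\<dots> = ?I (\<lambda>x. \<epsilon>\<^sup>2 * (?L a x * a x - ?L a x * b x)
      + r (Suc n) / s * (f x * (a x - b x)))"
  proof (rule Bochner_Integration.integral_cong)
    fix x assume "x \<in> space (lebesgue_on \<Omega>)"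
    then have x: "x \<in> \<Omega>" by (simp add: space_restrict_space)
    have "- (M * \<Delta>t) * (?L m x * m x) = (a x - b x) * m x"
      using incr[OF x] by simp
    also have "\<dots> = (a x - b x) * (\<epsilon>\<^sup>2 * ?L a x + r (Suc n) / s * f x)"
      using scheme_\<mu>[OF x] by (simp add: a_def m_def s_def f_def)
    finally show "- (M * \<Delta>t) * (?L m x * m x) = \<epsilon>\<^sup>2 * (?L a x * a x - ?L a x * b x)
        + r (Suc n) / s * (f x * (a x - b x))"
      by (simp add: algebra_simps diff_divide_distrib)
  qed simp
  also have "\<dots> = \<epsilon>\<^sup>2 * (?q a a - ?q a b) + r (Suc n) / s * ?I (\<lambda>x. f x * (a x - b x))"
    using La f unfolding inner_on_def by simp
  \<comment> \<open>The weight \<open>1 / (2 * s)\<close> in the update of \<open>r\<close> makes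
    \<open>s\<close> cancel: the nonlinear term becomes a product of scalars.\<close>
  also have "\<dots> = \<epsilon>\<^sup>2 * (?q a a - ?q a b) + 2 * r (Suc n) * (r (Suc n) - r n)"
    using s by (simp add: r)
  finally have "\<epsilon>\<^sup>2 * (?q a a - ?q a b) + 2 * r (Suc n) * (r (Suc n) - r n)
      = - (M * \<Delta>t) * ?q m m" by simp
  \<comment> \<open>Only the sign of \<open>\<Delta>t\<close> enters here, which is why stability is
    unconditional.\<close>
  also have "\<dots> \<le> 0"
    using inner_on_nonlocal_op_nonneg[OF \<Omega> reg(4) J_sym J_nonneg] params by simp
  finally have test: "\<epsilon>\<^sup>2 * (?q a a - ?q a b) + 2 * r (Suc n) * (r (Suc n) - r n) \<le> 0" .
  have "?q a a / 2 - ?q b b / 2 \<le> ?q a a - ?q a b"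
    using inner_on_nonlocal_op_cross_le[OF \<Omega> reg(1-3) J_sym J_nonneg] by simp
  then have "\<epsilon>\<^sup>2 * (?q a a / 2 - ?q b b / 2) \<le> \<epsilon>\<^sup>2 * (?q a a - ?q a b)"
    by (rule mult_left_mono) simp
  \<comment> \<open>Scalar analogue of the preceding bound: the two sides differ by the square of
    \<open>r (Suc n) - r n\<close>.\<close>
  moreover have "(r (Suc n))\<^sup>2 - (r n)\<^sup>2 \<le> 2 * r (Suc n) * (r (Suc n) - r n)"
    using zero_le_power2[of "r (Suc n) - r n"] by (simp add: power2_eq_square algebra_simps)
  ultimately have "\<epsilon>\<^sup>2 / 2 * ?q a a + (r (Suc n))\<^sup>2 \<le> \<epsilon>\<^sup>2 / 2 * ?q b b + (r n)\<^sup>2"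
    using test by (simp add: algebra_simps)
  then show ?thesis
    by (simp add: a_def b_def)
qed

end
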